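(* Let $(A,\ast,\circ)$ be a finite-dimensional pre-Poisson algebra and $(B=\oplus_{i\in\mathbb Z}B_i,\diamond)$ a $\mathbb Z$-graded perm algebra. Define on $A\otimes B$ $$(a_1\otimes b_1)\cdot(a_2\otimes b_2)=(a_1\ast a_2)\otimes(b_1\diamond b_2)+(a_2\ast a_1)\otimes(b_2\diamond b_1),$$ $$[a_1\otimes b_1,\;a_2\otimes b_2]=(a_1\circ a_2)\otimes(b_1\diamond b_2)-(a_2\circ a_1)\otimes(b_2\diamond b_1).$$ Then $(A\otimes B,\cdot,[-,-])$ is a $\mathbb Z$-graded Poisson algebra. Moreover, let $(B=\oplus_{i\in\mathbb Z}B_i,\diamond)$ be the Laurent $\mathbb Z$-graded perm algebra $B^L$ described in the context, and let $A$ be a finite-dimensional vector space with bilinear operations $\ast,\circ:A\otimes A\to A$. With $\cdot$ and $[-,-]$ defined on $A\otimes B$ by the same formulas, $(A\otimes B,\cdot,[-,-])$ is a $\mathbb Z$-graded Poisson algebra if and only if $(A,\ast,\circ)$ is a pre-Poisson algebra.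
   Context: All vector spaces are over a field $\mathbf k$ of characteristic zero. A Zinbiel algebra $(A,\ast)$: $a_1\ast(a_2\ast a_3)=(a_1\ast a_2)\ast a_3+(a_2\ast a_1)\ast a_3$. A pre-Lie algebra $(A,\circ)$: $(a_1\circ a_2)\circ a_3-a_1\circ(a_2\circ a_3)=(a_2\circ a_1)\circ a_3-a_2\circ(a_1\circ a_3)$. A pre-Poisson algebra $(A,\ast,\circ)$: $(A,\ast)$ Zinbiel, $(A,\circ)$ pre-Lie, and $(a_1\circ a_2-a_2\circ a_1)\ast a_3=a_1\circ(a_2\ast a_3)-a_2\ast(a_1\circ a_3)$, $(a_1\ast a_2+a_2\ast a_1)\circ a_3=a_1\ast(a_2\circ a_3)+a_2\ast(a_1\circ a_3)$. A perm algebra $(B,\diamond)$: $b_1\diamond(b_2\diamond b_3)=(b_1\diamond b_2)\diamond b_3=(b_2\diamond b_1)\diamond b_3$. A $\mathbb Z$-graded perm algebra is a perm algebra with a decomposition $B=\oplus_{i\in\mathbb Z}B_i$, each $B_i$ finite-dimensional, $B_i\diamond B_j\subseteq B_{i+j}$. A Poisson algebra $(P,\cdot,[-,-])$: $(P,\cdot)$ commutative associative, $(P,[-,-])$ Lie, $[p_1,p_2p_3]=[p_1,p_2]p_3+p_2[p_1,p_3]$. It is $\mathbb Z$-graded if $P=\oplus_{i\in\mathbb Z}P_i$ with each $P_i$ finite-dimensional, $P_iP_j\subseteq P_{i+j}$ and $[P_i,P_j]\subseteq P_{i+j}$. $A\otimes B$ is graded by the subspaces $A\otimes B_i$. Laurent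 $\mathbb Z$-graded perm algebra: $B^L=\{f_1\partial_1+f_2\partial_2\mid f_1,f_2\in\mathbf k[x_1^{\pm1},x_2^{\pm1}]\}$ with $(x_1^{i_1}x_2^{i_2}\partial_s)\diamond(x_1^{j_1}x_2^{j_2}\partial_t)=\delta_{s,1}x_1^{i_1+j_1+1}x_2^{i_2+j_2}\partial_t+\delta_{s,2}x_1^{i_1+j_1}x_2^{i_2+j_2+1}\partial_t$, regarded as $\mathbb Z$-graded by $B_i=\{f_1\partial_1+f_2\partial_2\mid f_1,f_2\text{ homogeneous of total degree }i-1\}$, $i\in\mathbb Z$.
   Formalization: In the Laurent equivalence, "Z-graded Poisson algebra" is taken without requiring finite-dimensional homogeneous components, since the components of B^L (hence of A⊗B^L for A≠0) are infinite-dimensional and the literal claim fails, e.g. for A = k with zero products. *)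

theory Defs
  imports Complex_Main "HOL-Library.Poly_Mapping" "HOL-Library.Product_Plus"
begin

section \<open>Vector spaces\<close>

definition bilinear_map ::
  "('k::field \<Rightarrow> 'a::ab_group_add \<Rightarrow> 'a) \<Rightarrow> ('k \<Rightarrow> 'b::ab_group_add \<Rightarrow> 'b) \<Rightarrow>
   ('k \<Rightarrow> 'c::ab_group_add \<Rightarrow> 'c) \<Rightarrow> ('a \<Rightarrow> 'b \<Rightarrow> 'c) \<Rightarrow> bool" where
  "bilinear_map s1 s2 s3 f \<longleftrightarrow>
     (\<forall>x. Vector_Spaces.linear s2 s3 (\<lambda>y. f x y)) \<and>
     (\<forall>y. Vector_Spaces.linear s1 s3 (\<lambda>x. f x y))"

definition finite_dim :: "('k::field \<Rightarrow> 'a::ab_group_add \<Rightarrow> 'a) \<Rightarrow> 'a set \<Rightarrow> bool" where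
  "finite_dim s V \<longleftrightarrow> (\<exists>S. finite S \<and> module.span s S = V)"

definition direct_sum_decomposition ::
  "('k::field \<Rightarrow> 'v::ab_group_add \<Rightarrow> 'v) \<Rightarrow> (int \<Rightarrow> 'v set) \<Rightarrow> bool" where
  "direct_sum_decomposition s G \<longleftrightarrow>
     (\<forall>i. module.subspace s (G i)) \<and>
     (\<forall>v. \<exists>!c. finite {i. c i \<noteq> 0} \<and> (\<forall>i. c i \<in> G i) \<and> v = (\<Sum>i | c i \<noteq> 0. c i))"


section \<open>Algebras\<close>

locale zinbiel_algebra =
  fixes scale :: "'k::field \<Rightarrow> 'a::ab_group_add \<Rightarrow> 'a" and ast :: "'a \<Rightarrow> 'a \<Rightarrow> 'a"
  assumes vector_space: "vector_space scale"
    and bilinear: "bilinear_map scale scale scale ast"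
    and zinbiel: "ast a1 (ast a2 a3) = ast (ast a1 a2) a3 + ast (ast a2 a1) a3"

locale pre_lie_algebra =
  fixes scale :: "'k::field \<Rightarrow> 'a::ab_group_add \<Rightarrow> 'a" and circ :: "'a \<Rightarrow> 'a \<Rightarrow> 'a"
  assumes vector_space: "vector_space scale"
    and bilinear: "bilinear_map scale scale scale circ"
    and pre_lie: "circ (circ a1 a2) a3 - circ a1 (circ a2 a3) =
                  circ (circ a2 a1) a3 - circ a2 (circ a1 a3)"

locale pre_poisson_algebra =
  ast: zinbiel_algebra scale ast + circ: pre_lie_algebra scale circ
  for scale :: "'k::field \<Rightarrow> 'a::ab_group_add \<Rightarrow> 'a"
    and ast :: "'a \<Rightarrow> 'a \<Rightarrow> 'a" and circ :: "'a \<Rightarrow> 'a \<Rightarrow> 'a" +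
  assumes circ_ast: "ast (circ a1 a2 - circ a2 a1) a3 = circ a1 (ast a2 a3) - ast a2 (circ a1 a3)"
    and ast_circ: "circ (ast a1 a2 + ast a2 a1) a3 = ast a1 (circ a2 a3) + ast a2 (circ a1 a3)"

locale perm_algebra =
  fixes scale :: "'k::field \<Rightarrow> 'b::ab_group_add \<Rightarrow> 'b" and dia :: "'b \<Rightarrow> 'b \<Rightarrow> 'b"
  assumes vector_space: "vector_space scale"
    and bilinear: "bilinear_map scale scale scale dia"
    and assoc: "dia b1 (dia b2 b3) = dia (dia b1 b2) b3"
    and left_comm: "dia (dia b1 b2) b3 = dia (dia b2 b1) b3"

locale poisson_algebra =
  fixes scale :: "'k::field \<Rightarrow> 'p::ab_group_add \<Rightarrow> 'p"
    and dot :: "'p \<Rightarrow> 'p \<Rightarrow> 'p" and bracket :: "'p \<Rightarrow> 'p \<Rightarrow> 'p"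
  assumes vector_space: "vector_space scale"
    and dot_bilinear: "bilinear_map scale scale scale dot"
    and dot_commute: "dot p1 p2 = dot p2 p1"
    and dot_assoc: "dot (dot p1 p2) p3 = dot p1 (dot p2 p3)"
    and bracket_bilinear: "bilinear_map scale scale scale bracket"
    and bracket_self: "bracket p p = 0"
    and jacobi: "bracket p1 (bracket p2 p3) + bracket p2 (bracket p3 p1)
                   + bracket p3 (bracket p1 p2) = 0"
    and leibniz: "bracket p1 (dot p2 p3) = dot (bracket p1 p2) p3 + dot p2 (bracket p1 p3)"


section \<open>Graded algebras\<close>

text \<open>
  The \<open>graded_\<close> predicates contain the decomposition and the compatibility of the products with
  it; the \<open>Z_graded_\<close> predicates require in addition that every homogeneous component is
  finite-dimensional. The two are kept apart because the components of the Laurent perm algebra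
  are infinite-dimensional (lemma \<open>laurent_component_not_finite_dim\<close> below).
\<close>

definition graded_perm_algebra ::
  "('k::field \<Rightarrow> 'b::ab_group_add \<Rightarrow> 'b) \<Rightarrow> ('b \<Rightarrow> 'b \<Rightarrow> 'b) \<Rightarrow> (int \<Rightarrow> 'b set) \<Rightarrow> bool" where
  "graded_perm_algebra s dia G \<longleftrightarrow>
     perm_algebra s dia \<and> direct_sum_decomposition s G \<and>
     (\<forall>i j. \<forall>x\<in>G i. \<forall>y\<in>G j. dia x y \<in> G (i + j))"

definition Z_graded_perm_algebra ::
  "('k::field \<Rightarrow> 'b::ab_group_add \<Rightarrow> 'b) \<Rightarrow> ('b \<Rightarrow> 'b \<Rightarrow> 'b) \<Rightarrow> (int \<Rightarrow> 'b set) \<Rightarrow> bool" where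
  "Z_graded_perm_algebra s dia G \<longleftrightarrow>
     graded_perm_algebra s dia G \<and> (\<forall>i. finite_dim s (G i))"

definition graded_poisson_algebra ::
  "('k::field \<Rightarrow> 'p::ab_group_add \<Rightarrow> 'p) \<Rightarrow> ('p \<Rightarrow> 'p \<Rightarrow> 'p) \<Rightarrow> ('p \<Rightarrow> 'p \<Rightarrow> 'p) \<Rightarrow>
   (int \<Rightarrow> 'p set) \<Rightarrow> bool" where
  "graded_poisson_algebra s dot bracket G \<longleftrightarrow>
     poisson_algebra s dot bracket \<and> direct_sum_decomposition s G \<and>
     (\<forall>i j. \<forall>x\<in>G i. \<forall>y\<in>G j. dot x y \<in> G (i + j)) \<and>
     (\<forall>i j. \<forall>x\<in>G i. \<forall>y\<in>G j. bracket x y \<in> G (i + j))"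

definition Z_graded_poisson_algebra ::
  "('k::field \<Rightarrow> 'p::ab_group_add \<Rightarrow> 'p) \<Rightarrow> ('p \<Rightarrow> 'p \<Rightarrow> 'p) \<Rightarrow> ('p \<Rightarrow> 'p \<Rightarrow> 'p) \<Rightarrow>
   (int \<Rightarrow> 'p set) \<Rightarrow> bool" where
  "Z_graded_poisson_algebra s dot bracket G \<longleftrightarrow>
     graded_poisson_algebra s dot bracket G \<and> (\<forall>i. finite_dim s (G i))"


section \<open>Tensor products\<close>

text \<open>
  The type \<open>'x \<Rightarrow>\<^sub>0 'k\<close> is the free vector space on \<open>'x\<close>, with basis the
  \<open>Poly_Mapping.single x 1\<close>.
\<close>

definition free_scale :: "'k::field \<Rightarrow> ('x \<Rightarrow>\<^sub>0 'k) \<Rightarrow> ('x \<Rightarrow>\<^sub>0 'k)" where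
  "free_scale c = Poly_Mapping.map ((*) c)"

definition free_extend ::
  "('k::field \<Rightarrow> 'v::ab_group_add \<Rightarrow> 'v) \<Rightarrow> ('x \<Rightarrow> 'v) \<Rightarrow> ('x \<Rightarrow>\<^sub>0 'k) \<Rightarrow> 'v" where
  "free_extend s g f = (\<Sum>x\<in>Poly_Mapping.keys f. s (Poly_Mapping.lookup f x) (g x))"

definition tensor_relators ::
  "('k::field \<Rightarrow> 'a::ab_group_add \<Rightarrow> 'a) \<Rightarrow> ('k \<Rightarrow> 'b::ab_group_add \<Rightarrow> 'b) \<Rightarrow>
   (('a \<times> 'b) \<Rightarrow>\<^sub>0 'k) set" where
  "tensor_relators sA sB =
     {Poly_Mapping.single (a + a', b) 1 - Poly_Mapping.single (a, b) 1
        - Poly_Mapping.single (a', b) 1 | a a' b. True} \<union>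
     {Poly_Mapping.single (a, b + b') 1 - Poly_Mapping.single (a, b) 1
        - Poly_Mapping.single (a, b') 1 | a b b'. True} \<union>
     {Poly_Mapping.single (sA c a, b) 1 - free_scale c (Poly_Mapping.single (a, b) 1)
        | c a b. True} \<union>
     {Poly_Mapping.single (a, sB c b) 1 - free_scale c (Poly_Mapping.single (a, b) 1)
        | c a b. True}"

text \<open>
  \<open>T\<close> with \<open>(a, b) \<mapsto> a \<otimes> b\<close> is the tensor product of \<open>A\<close> and \<open>B\<close>: the linear extension of
  \<open>(a, b) \<mapsto> a \<otimes> b\<close> to the free vector space on \<open>A \<times> B\<close> is onto \<open>T\<close> and its kernel is spanned
  by the bilinearity relators, so \<open>T\<close> is the usual quotient. This is a predicate on \<open>T\<close> because
  the quotient depends on the scalar multiplications, which a type cannot. The universal property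
  is \<open>tensor_product_universal\<close>.
\<close>

locale tensor_product =
  fixes sA :: "'k::field \<Rightarrow> 'a::ab_group_add \<Rightarrow> 'a"
    and sB :: "'k \<Rightarrow> 'b::ab_group_add \<Rightarrow> 'b"
    and sT :: "'k \<Rightarrow> 't::ab_group_add \<Rightarrow> 't"
    and tens :: "'a \<Rightarrow> 'b \<Rightarrow> 't"
  assumes vector_space_left: "vector_space sA"
    and vector_space_right: "vector_space sB"
    and vector_space_tensor: "vector_space sT"
    and surj: "range (free_extend sT (\<lambda>(a, b). tens a b)) = UNIV"
    and kernel: "{f. free_extend sT (\<lambda>(a, b). tens a b) f = 0} =
                 module.span free_scale (tensor_relators sA sB)"

lemma lookup_free_scale [simp]:
  "Poly_Mapping.lookup (free_scale c f) x = c * Poly_Mapping.lookup f x"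
  by (simp add: free_scale_def map.rep_eq when_def)

lemma vector_space_free_scale: "vector_space (free_scale :: 'k::field \<Rightarrow> ('x \<Rightarrow>\<^sub>0 'k) \<Rightarrow> _)"
  by unfold_locales (auto intro!: poly_mapping_eqI simp: lookup_add algebra_simps)

lemma free_extend_superset:
  assumes "vector_space s" "finite K" "Poly_Mapping.keys f \<subseteq> K"
  shows "free_extend s g f = (\<Sum>x\<in>K. s (Poly_Mapping.lookup f x) (g x))"
proof -
  interpret vector_space s by fact
  show ?thesis
    unfolding free_extend_def using assms(2,3)
    by (intro sum.mono_neutral_left) (auto simp: in_keys_iff)
qed

lemma linear_free_extend:
  assumes "vector_space s"
  shows "Vector_Spaces.linear free_scale s (free_extend s g)"
proof -
  interpret vector_space s by fact
  interpret F: vector_space "free_scale :: 'a \<Rightarrow> ('c \<Rightarrow>\<^sub>0 'a) \<Rightarrow> _" by (rule vector_space_free_scale)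
  show ?thesis
  proof (unfold_locales, goal_cases)
    case (1 f h)
    let ?K = "Poly_Mapping.keys f \<union> Poly_Mapping.keys h"
    have "Poly_Mapping.keys (f + h) \<subseteq> ?K" by (rule keys_add)
    then show ?case
      by (simp add: free_extend_superset[OF assms, of ?K] lookup_add scale_left_distrib sum.distrib)
  next
    case (2 c f)
    have "Poly_Mapping.keys (free_scale c f) \<subseteq> Poly_Mapping.keys f" by (auto simp: in_keys_iff)
    then show ?case
      by (simp add: free_extend_superset[OF assms, of "Poly_Mapping.keys f"] scale_sum_right)
  qed
qed

lemma free_extend_single:
  assumes "vector_space s"
  shows "free_extend s g (Poly_Mapping.single x c) = s c (g x)"
proof -
  interpret vector_space s by fact
  show ?thesis
    by (simp add: free_extend_superset[OF assms, of "{x}"])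
qed

lemma bilinear_mapD:
  assumes "bilinear_map s1 s2 s3 f"
  shows "f (x + x') y = f x y + f x' y" "f x (y + y') = f x y + f x y'"
    "f (s1 c x) y = s3 c (f x y)" "f x (s2 c y) = s3 c (f x y)"
proof -
  have "Vector_Spaces.linear s2 s3 (\<lambda>y. f x y)" "Vector_Spaces.linear s1 s3 (\<lambda>x. f x y)"
    using assms by (auto simp: bilinear_map_def)
  then interpret l1: Vector_Spaces.linear s2 s3 "\<lambda>y. f x y"
    + l2: Vector_Spaces.linear s1 s3 "\<lambda>x. f x y" by auto
  show "f (x + x') y = f x y + f x' y" "f x (y + y') = f x y + f x y'"
    "f (s1 c x) y = s3 c (f x y)" "f x (s2 c y) = s3 c (f x y)"
    by (rule l2.add l1.add l2.scale l1.scale)+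
qed

lemma linear_iff:
  "Vector_Spaces.linear s1 s2 f \<longleftrightarrow> vector_space s1 \<and> vector_space s2 \<and>
     (\<forall>x y. f (x + y) = f x + f y) \<and> (\<forall>c x. f (s1 c x) = s2 c (f x))"
  unfolding Vector_Spaces.linear_def module_hom_def module_hom_axioms_def vector_space_def module_def
  by auto

lemma bilinear_mapI:
  assumes "vector_space s1" "vector_space s2" "vector_space s3"
    and "\<And>x x' y. f (x + x') y = f x y + f x' y" "\<And>x y y'. f x (y + y') = f x y + f x y'"
    "\<And>c x y. f (s1 c x) y = s3 c (f x y)" "\<And>c x y. f x (s2 c y) = s3 c (f x y)"
  shows "bilinear_map s1 s2 s3 f"
  using assms by (simp add: bilinear_map_def linear_iff)

lemma tensor_product_bilinear:
  assumes "tensor_product sA sB sT tens"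
  shows "bilinear_map sA sB sT tens"
proof -
  interpret tensor_product sA sB sT tens by fact
  interpret F: vector_space "free_scale :: 'a \<Rightarrow> (('b \<times> 'c) \<Rightarrow>\<^sub>0 'a) \<Rightarrow> _"
    by (rule vector_space_free_scale)
  interpret T: vector_space sT by (rule vector_space_tensor)
  let ?e = "free_extend sT (\<lambda>(a, b). tens a b)"
  interpret e: Vector_Spaces.linear free_scale sT ?e
    by (rule linear_free_extend) (rule vector_space_tensor)
  have e0: "?e r = 0" if "r \<in> tensor_relators sA sB" for r
    using kernel F.span_base[OF that] by auto
  note es = free_extend_single[OF vector_space_tensor]
  show ?thesis
  proof (rule bilinear_mapI)
    fix a a' b
    have "?e (Poly_Mapping.single (a + a', b) 1 - Poly_Mapping.single (a, b) 1
        - Poly_Mapping.single (a', b) 1) = 0"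
      by (rule e0) (unfold tensor_relators_def, blast)
    then show "tens (a + a') b = tens a b + tens a' b"
      by (simp add: e.diff es diff_eq_eq add.commute)
  next
    fix a b b'
    have "?e (Poly_Mapping.single (a, b + b') 1 - Poly_Mapping.single (a, b) 1
        - Poly_Mapping.single (a, b') 1) = 0"
      by (rule e0) (unfold tensor_relators_def, blast)
    then show "tens a (b + b') = tens a b + tens a b'"
      by (simp add: e.diff es diff_eq_eq add.commute)
  next
    fix c a b
    have "?e (Poly_Mapping.single (sA c a, b) 1 - free_scale c (Poly_Mapping.single (a, b) 1)) = 0"
      by (rule e0) (unfold tensor_relators_def, blast)
    then show "tens (sA c a) b = sT c (tens a b)"
      by (simp add: e.diff e.scale es)
  next
    fix c a b
    have "?e (Poly_Mapping.single (a, sB c b) 1 - free_scale c (Poly_Mapping.single (a, b) 1)) = 0"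
      by (rule e0) (unfold tensor_relators_def, blast)
    then show "tens a (sB c b) = sT c (tens a b)"
      by (simp add: e.diff e.scale es)
  qed (fact vector_space_left vector_space_right vector_space_tensor)+
qed

lemma tensor_product_linear_eqI:
  assumes T: "tensor_product sA sB sT tens"
    and f: "Vector_Spaces.linear sT sU f" and g: "Vector_Spaces.linear sT sU g"
    and eq: "\<And>a b. f (tens a b) = g (tens a b)"
  shows "f = g"
proof
  fix t
  interpret tensor_product sA sB sT tens by fact
  interpret f: Vector_Spaces.linear sT sU f by fact
  interpret g: Vector_Spaces.linear sT sU g by fact
  obtain h where t: "t = free_extend sT (\<lambda>(a, b). tens a b) h"
    using surj by blast
  show "f t = g t"
    unfolding t free_extend_def
    by (simp add: f.sum g.sum f.scale g.scale eq case_prod_unfold)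
qed

lemma tensor_product_universal:
  assumes T: "tensor_product sA sB sT tens" and b: "bilinear_map sA sB sU \<beta>"
  shows "\<exists>!\<phi>. Vector_Spaces.linear sT sU \<phi> \<and> (\<forall>a b. \<phi> (tens a b) = \<beta> a b)"
proof -
  interpret tensor_product sA sB sT tens by fact
  interpret F: vector_space "free_scale :: 'a \<Rightarrow> (('b \<times> 'c) \<Rightarrow>\<^sub>0 'a) \<Rightarrow> _"
    by (rule vector_space_free_scale)
  interpret T: vector_space sT by (rule vector_space_tensor)
  have U: "vector_space sU" using b by (auto simp: bilinear_map_def linear_iff)
  interpret U: vector_space sU by (rule U)
  define e where "e = free_extend sT (\<lambda>(a, b). tens a b)"
  define h where "h = free_extend sU (\<lambda>(a, b). \<beta> a b)"
  interpret e: Vector_Spaces.linear free_scale sT e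
    unfolding e_def by (rule linear_free_extend) (rule vector_space_tensor)
  interpret h: Vector_Spaces.linear free_scale sU h
    unfolding h_def by (rule linear_free_extend) (rule U)
  have h1: "h (Poly_Mapping.single (a, b) 1) = \<beta> a b" for a b
    by (simp add: h_def free_extend_single[OF U])
  have e1: "e (Poly_Mapping.single (a, b) 1) = tens a b" for a b
    by (simp add: e_def free_extend_single[OF vector_space_tensor])
  have hrel: "h r = 0" if "r \<in> tensor_relators sA sB" for r
    using that unfolding tensor_relators_def
    by (auto simp: h.diff h.scale h1 bilinear_mapD[OF b])
  have hker: "h f = 0" if "e f = 0" for f
  proof -
    have "f \<in> F.span (tensor_relators sA sB)" using kernel that unfolding e_def by blast
    then show ?thesis by (induction rule: F.span_induct_alt) (auto simp: h.add h.scale hrel)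
  qed
  have heq: "h f = h g" if "e f = e g" for f g
    using hker[of "f - g"] that by (simp add: e.diff h.diff)
  define \<phi> where "\<phi> t = h (SOME f. e f = t)" for t
  have phi: "\<phi> (e f) = h f" for f
    unfolding \<phi>_def by (rule heq, rule someI, rule refl)
  have ex: "\<exists>f. t = e f" for t using surj unfolding e_def by blast
  have "Vector_Spaces.linear sT sU \<phi>"
    unfolding linear_iff
  proof (intro conjI allI)
    fix x y
    obtain f g where "x = e f" "y = e g" using ex by blast
    then show "\<phi> (x + y) = \<phi> x + \<phi> y" by (metis phi e.add h.add)
  next
    fix c x
    obtain f where "x = e f" using ex by blast
    then show "\<phi> (sT c x) = sU c (\<phi> x)" by (metis phi e.scale h.scale)
  qed (fact vector_space_tensor U)+
  moreover have "\<forall>a b. \<phi> (tens a b) = \<beta> a b" by (metis phi e1 h1)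
  ultimately show ?thesis
    by (intro ex1I[of _ \<phi>] tensor_product_linear_eqI[OF T]) auto
qed


section \<open>The products on the tensor product\<close>

text \<open>
  The bilinear operation on \<open>A \<otimes> B\<close> determined by
  \<open>(a1 \<otimes> b1, a2 \<otimes> b2) \<mapsto> (a1 * a2) \<otimes> (b1 \<diamond> b2) + (a2 * a1) \<otimes> (b2 \<diamond> b1)\<close>, and its analogue with
  a minus sign; they exist and are unique by \<open>tensor_op_well_defined\<close>.
\<close>

definition tensor_dot ::
  "('k::field \<Rightarrow> 't::ab_group_add \<Rightarrow> 't) \<Rightarrow> ('a \<Rightarrow> 'b \<Rightarrow> 't) \<Rightarrow>
   ('a \<Rightarrow> 'a \<Rightarrow> 'a) \<Rightarrow> ('b \<Rightarrow> 'b \<Rightarrow> 'b) \<Rightarrow> 't \<Rightarrow> 't \<Rightarrow> 't" where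
  "tensor_dot sT tens ast dia = (THE m. bilinear_map sT sT sT m \<and>
     (\<forall>a1 b1 a2 b2. m (tens a1 b1) (tens a2 b2) =
        tens (ast a1 a2) (dia b1 b2) + tens (ast a2 a1) (dia b2 b1)))"

definition tensor_bracket ::
  "('k::field \<Rightarrow> 't::ab_group_add \<Rightarrow> 't) \<Rightarrow> ('a \<Rightarrow> 'b \<Rightarrow> 't) \<Rightarrow>
   ('a \<Rightarrow> 'a \<Rightarrow> 'a) \<Rightarrow> ('b \<Rightarrow> 'b \<Rightarrow> 'b) \<Rightarrow> 't \<Rightarrow> 't \<Rightarrow> 't" where
  "tensor_bracket sT tens circ dia = (THE m. bilinear_map sT sT sT m \<and>
     (\<forall>a1 b1 a2 b2. m (tens a1 b1) (tens a2 b2) =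
        tens (circ a1 a2) (dia b1 b2) - tens (circ a2 a1) (dia b2 b1)))"

definition tensor_grading ::
  "('k::field \<Rightarrow> 't::ab_group_add \<Rightarrow> 't) \<Rightarrow> ('a \<Rightarrow> 'b \<Rightarrow> 't) \<Rightarrow> (int \<Rightarrow> 'b set) \<Rightarrow> int \<Rightarrow> 't set"
  where
  "tensor_grading sT tens G i = module.span sT {tens a b | a b. b \<in> G i}"

lemma tensor_product_bilinear_ext:
  assumes T: "tensor_product sA sB sT tens"
    and r: "\<And>a b. bilinear_map sA sB sT (\<lambda>a' b'. F a b a' b')"
    and l: "\<And>a' b'. bilinear_map sA sB sT (\<lambda>a b. F a b a' b')"
  shows "\<exists>!m. bilinear_map sT sT sT m \<and> (\<forall>a b a' b'. m (tens a b) (tens a' b') = F a b a' b')"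
proof -
  interpret tensor_product sA sB sT tens by fact
  interpret T: vector_space sT by (rule vector_space_tensor)
  note VT = vector_space_tensor
  have "\<exists>L. \<forall>a b. Vector_Spaces.linear sT sT (L a b) \<and>
      (\<forall>a' b'. L a b (tens a' b') = F a b a' b')"
    using tensor_product_universal[OF T r] by metis
  then obtain L where L: "\<And>a b. Vector_Spaces.linear sT sT (L a b)"
    "\<And>a b a' b'. L a b (tens a' b') = F a b a' b'" by metis
  note Ll = L(1)[unfolded linear_iff]
  have bl: "bilinear_map sA sB sT (\<lambda>a b. L a b t)" for t
  proof (rule bilinear_mapI)
    fix a1 a2 b
    have "L (a1 + a2) b = (\<lambda>t. L a1 b t + L a2 b t)"
      by (rule tensor_product_linear_eqI[OF T L(1), of _ _ ])
        (use Ll in \<open>auto simp: linear_iff L(2) bilinear_mapD[OF l] T.scale_right_distrib\<close>)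
    then show "L (a1 + a2) b t = L a1 b t + L a2 b t" by metis
  next
    fix a b1 b2
    have "L a (b1 + b2) = (\<lambda>t. L a b1 t + L a b2 t)"
      by (rule tensor_product_linear_eqI[OF T L(1), of _ _ ])
        (use Ll in \<open>auto simp: linear_iff L(2) bilinear_mapD[OF l] T.scale_right_distrib\<close>)
    then show "L a (b1 + b2) t = L a b1 t + L a b2 t" by metis
  next
    fix c a b
    have "L (sA c a) b = (\<lambda>t. sT c (L a b t))"
      by (rule tensor_product_linear_eqI[OF T L(1), of _ _ ])
        (use Ll in \<open>auto simp: linear_iff L(2) bilinear_mapD[OF l] T.scale_right_distrib mult.commute\<close>)
    then show "L (sA c a) b t = sT c (L a b t)" by metis
  next
    fix c a b
    have "L a (sB c b) = (\<lambda>t. sT c (L a b t))"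
      by (rule tensor_product_linear_eqI[OF T L(1), of _ _ ])
        (use Ll in \<open>auto simp: linear_iff L(2) bilinear_mapD[OF l] T.scale_right_distrib mult.commute\<close>)
    then show "L a (sB c b) t = sT c (L a b t)" by metis
  qed (fact vector_space_left vector_space_right vector_space_tensor)+
  have "\<exists>M. \<forall>t. Vector_Spaces.linear sT sT (M t) \<and> (\<forall>a b. M t (tens a b) = L a b t)"
    using tensor_product_universal[OF T bl] by metis
  then obtain M where M: "\<And>t. Vector_Spaces.linear sT sT (M t)"
    "\<And>t a b. M t (tens a b) = L a b t" by metis
  note Ml = M(1)[unfolded linear_iff]
  have bM: "bilinear_map sT sT sT (\<lambda>x y. M y x)"
  proof (rule bilinear_mapI)
    fix x y y'
    have "M (y + y') = (\<lambda>x. M y x + M y' x)"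
      by (rule tensor_product_linear_eqI[OF T M(1), of _ _ ])
        (use Ml Ll in \<open>auto simp: linear_iff M(2) T.scale_right_distrib\<close>)
    then show "M (y + y') x = M y x + M y' x" by metis
  next
    fix c x y
    have "M (sT c y) = (\<lambda>x. sT c (M y x))"
      by (rule tensor_product_linear_eqI[OF T M(1), of _ _ ])
        (use Ml Ll in \<open>auto simp: linear_iff M(2) T.scale_right_distrib mult.commute\<close>)
    then show "M (sT c y) x = sT c (M y x)" by metis
  qed (use Ml VT in auto)
  show ?thesis
  proof (rule ex1I[of _ "\<lambda>x y. M y x"])
    show "bilinear_map sT sT sT (\<lambda>x y. M y x) \<and>
      (\<forall>a b a' b'. M (tens a' b') (tens a b) = F a b a' b')"
      using bM by (simp add: M(2) L(2))
  next
    fix m assume m: "bilinear_map sT sT sT m \<and>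
      (\<forall>a b a' b'. m (tens a b) (tens a' b') = F a b a' b')"
    have m1: "m (tens a b) y = M y (tens a b)" for a b y
    proof -
      have "m (tens a b) = L a b"
        by (rule tensor_product_linear_eqI[OF T _ L(1)])
          (use m in \<open>auto simp: bilinear_map_def L(2)\<close>)
      then show ?thesis by (simp add: M(2))
    qed
    have "(\<lambda>x. m x y) = M y" for y
      by (rule tensor_product_linear_eqI[OF T _ M(1)])
        (use m in \<open>auto simp: bilinear_map_def m1\<close>)
    then show "m = (\<lambda>x y. M y x)" by (intro ext) metis
  qed
qed

lemma tensor_op_well_defined:
  assumes T: "tensor_product sA sB sT tens"
    and p: "bilinear_map sA sA sA p" and q: "bilinear_map sB sB sB q"
  shows "\<exists>!m. bilinear_map sT sT sT m \<and> (\<forall>a1 b1 a2 b2. m (tens a1 b1) (tens a2 b2) =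
           tens (p a1 a2) (q b1 b2) + tens (p a2 a1) (q b2 b1))"
    and "\<exists>!m. bilinear_map sT sT sT m \<and> (\<forall>a1 b1 a2 b2. m (tens a1 b1) (tens a2 b2) =
           tens (p a1 a2) (q b1 b2) - tens (p a2 a1) (q b2 b1))"
proof -
  interpret tensor_product sA sB sT tens by fact
  interpret T: vector_space sT by (rule vector_space_tensor)
  note b = bilinear_mapD[OF tensor_product_bilinear[OF T]] bilinear_mapD[OF p] bilinear_mapD[OF q]
  note V = vector_space_left vector_space_right vector_space_tensor
  show "\<exists>!m. bilinear_map sT sT sT m \<and> (\<forall>a1 b1 a2 b2. m (tens a1 b1) (tens a2 b2) =
           tens (p a1 a2) (q b1 b2) + tens (p a2 a1) (q b2 b1))"
    by (rule tensor_product_bilinear_ext[OF T];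
        rule bilinear_mapI[OF V]; simp add: b T.scale_right_distrib algebra_simps)
  show "\<exists>!m. bilinear_map sT sT sT m \<and> (\<forall>a1 b1 a2 b2. m (tens a1 b1) (tens a2 b2) =
           tens (p a1 a2) (q b1 b2) - tens (p a2 a1) (q b2 b1))"
    by (rule tensor_product_bilinear_ext[OF T];
        rule bilinear_mapI[OF V]; simp add: b T.scale_right_diff_distrib algebra_simps)
qed


section \<open>The Laurent perm algebra\<close>

text \<open>
  Laurent polynomials in \<open>x1, x2\<close> are finitely supported functions on exponents in
  \<open>\<int> \<times> \<int>\<close> with the convolution product, and the pair \<open>(f1, f2)\<close> stands for
  \<open>f1 \<partial>1 + f2 \<partial>2\<close>.
\<close>

type_synonym 'k laurent2 = "(int \<times> int) \<Rightarrow>\<^sub>0 'k"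

definition laurent_x1 :: "'k::field laurent2" where
  "laurent_x1 = Poly_Mapping.single (1, 0) 1"

definition laurent_x2 :: "'k::field laurent2" where
  "laurent_x2 = Poly_Mapping.single (0, 1) 1"

definition laurent_scale ::
  "'k::field \<Rightarrow> 'k laurent2 \<times> 'k laurent2 \<Rightarrow> 'k laurent2 \<times> 'k laurent2" where
  "laurent_scale c F = (free_scale c (fst F), free_scale c (snd F))"

text \<open>
  \<open>(f1 \<partial>1 + f2 \<partial>2) \<diamond> (g1 \<partial>1 + g2 \<partial>2) = (x1 f1 + x2 f2) (g1 \<partial>1 + g2 \<partial>2)\<close>; see
  \<open>laurent_perm_monom\<close> for the values on monomials.
\<close>

definition laurent_perm ::
  "'k::field laurent2 \<times> 'k laurent2 \<Rightarrow> 'k laurent2 \<times> 'k laurent2 \<Rightarrow> 'k laurent2 \<times> 'k laurent2"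
  where
  "laurent_perm F G =
     (let h = laurent_x1 * fst F + laurent_x2 * snd F in (h * fst G, h * snd G))"

definition laurent_grading :: "int \<Rightarrow> ('k::field laurent2 \<times> 'k laurent2) set" where
  "laurent_grading i =
     {F. (\<forall>(m, n)\<in>Poly_Mapping.keys (fst F). m + n = i - 1) \<and>
         (\<forall>(m, n)\<in>Poly_Mapping.keys (snd F). m + n = i - 1)}"

text \<open>\<open>laurent_monom i1 i2 s\<close> is \<open>x1^i1 x2^i2 \<partial>s\<close> for \<open>s \<in> {1, 2}\<close>.\<close>

definition laurent_monom :: "int \<Rightarrow> int \<Rightarrow> nat \<Rightarrow> 'k::field laurent2 \<times> 'k laurent2" where
  "laurent_monom i1 i2 s =
     (if s = 1 then Poly_Mapping.single (i1, i2) 1 else 0,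
      if s = 2 then Poly_Mapping.single (i1, i2) 1 else 0)"

lemma free_scale_conv_mult:
  "free_scale c f = Poly_Mapping.single (0 :: 'x::monoid_add) c * f"
  by (simp add: free_scale_def mult_map_scale_conv_mult)

lemma laurent_perm_monom:
  assumes "s \<in> {1, 2}" "t \<in> {1, 2}"
  shows "laurent_perm (laurent_monom i1 i2 s) (laurent_monom j1 j2 t) =
    laurent_scale (of_bool (s = 1)) (laurent_monom (i1 + j1 + 1) (i2 + j2) t) +
    laurent_scale (of_bool (s = 2)) (laurent_monom (i1 + j1) (i2 + j2 + 1) t)"
proof -
  have [simp]: "free_scale 0 f = 0" "free_scale 1 f = f" for f :: "'k::field laurent2"
    by (rule poly_mapping_eqI, simp)+
  show ?thesis
    using assms
    by (elim insertE emptyE)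
      (simp_all add: laurent_perm_def laurent_monom_def laurent_scale_def laurent_x1_def
        laurent_x2_def mult_single algebra_simps)
qed

lemma vector_space_laurent_scale: "vector_space (laurent_scale :: 'k::field \<Rightarrow> _)"
proof -
  interpret F: vector_space "free_scale :: 'k \<Rightarrow> 'k laurent2 \<Rightarrow> _"
    by (rule vector_space_free_scale)
  show ?thesis
    by unfold_locales
      (auto simp: laurent_scale_def F.scale_right_distrib F.scale_left_distrib)
qed

lemma perm_algebra_laurent: "perm_algebra (laurent_scale :: 'k::field \<Rightarrow> _) laurent_perm"
proof (rule perm_algebra.intro)
  show "bilinear_map (laurent_scale :: 'k \<Rightarrow> _) laurent_scale laurent_scale laurent_perm"
    by (rule bilinear_mapI[OF vector_space_laurent_scale vector_space_laurent_scale
          vector_space_laurent_scale])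
      (auto simp: laurent_perm_def laurent_scale_def free_scale_conv_mult Let_def algebra_simps)
qed (rule vector_space_laurent_scale, simp_all add: laurent_perm_def Let_def algebra_simps)

lift_definition laurent_part :: "int \<Rightarrow> 'k::field laurent2 \<Rightarrow> 'k laurent2" is
  "\<lambda>d f p. if fst p + snd p = d then f p else 0"
  by (rule finite_subset) auto

lemma graded_perm_algebra_laurent:
  "graded_perm_algebra (laurent_scale :: 'k::field \<Rightarrow> _) laurent_perm laurent_grading"
proof -
  interpret vector_space "laurent_scale :: 'k \<Rightarrow> _" by (rule vector_space_laurent_scale)
  have G: "F \<in> laurent_grading i \<longleftrightarrow>
      (\<forall>m n. m + n \<noteq> i - 1 \<longrightarrow> Poly_Mapping.lookup (fst F) (m, n) = 0 \<and>
                           Poly_Mapping.lookup (snd F) (m, n) = 0)"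
    for F :: "'k laurent2 \<times> 'k laurent2" and i
    unfolding laurent_grading_def by (auto simp: in_keys_iff)
  have part: "Poly_Mapping.lookup (laurent_part d f) (m, n) =
      (if m + n = d then Poly_Mapping.lookup f (m, n) else 0)" for d m n and f :: "'k laurent2"
    by transfer simp
  have sub: "subspace (laurent_grading i)" for i
    by (rule subspaceI) (auto simp: G lookup_add laurent_scale_def)
  have "\<exists>!c. finite {i. c i \<noteq> 0} \<and> (\<forall>i. c i \<in> laurent_grading i) \<and> F = (\<Sum>i | c i \<noteq> 0. c i)"
    for F :: "'k laurent2 \<times> 'k laurent2"
  proof -
    define c where "c i = (laurent_part (i - 1) (fst F), laurent_part (i - 1) (snd F))" for i
    have look: "Poly_Mapping.lookup (fst (\<Sum>i | e i \<noteq> 0. e i)) (m, n) =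
          Poly_Mapping.lookup (fst (e (m + n + 1))) (m, n) \<and>
        Poly_Mapping.lookup (snd (\<Sum>i | e i \<noteq> 0. e i)) (m, n) =
          Poly_Mapping.lookup (snd (e (m + n + 1))) (m, n)"
      if e: "finite {i. e i \<noteq> 0}" "\<forall>i. e i \<in> laurent_grading i"
      for e :: "int \<Rightarrow> 'k laurent2 \<times> 'k laurent2" and m n
    proof -
      have "(\<Sum>i | e i \<noteq> 0. Poly_Mapping.lookup (fst (e i)) (m, n)) =
            (\<Sum>i\<in>{m + n + 1}. Poly_Mapping.lookup (fst (e i)) (m, n))"
        using e by (intro sum.mono_neutral_cong) (auto simp: G)
      moreover have "(\<Sum>i | e i \<noteq> 0. Poly_Mapping.lookup (snd (e i)) (m, n)) =
            (\<Sum>i\<in>{m + n + 1}. Poly_Mapping.lookup (snd (e i)) (m, n))"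
        using e by (intro sum.mono_neutral_cong) (auto simp: G)
      ultimately show ?thesis by (simp add: fst_sum snd_sum lookup_sum)
    qed
    have fin: "finite {i. c i \<noteq> 0}"
    proof (rule finite_subset)
      let ?K = "Poly_Mapping.keys (fst F) \<union> Poly_Mapping.keys (snd F)"
      show "{i. c i \<noteq> 0} \<subseteq> (\<lambda>(m, n). m + n + 1) ` ?K"
      proof
        fix i assume "i \<in> {i. c i \<noteq> 0}"
        then obtain m n where "Poly_Mapping.lookup (fst (c i)) (m, n) \<noteq> 0 \<or>
            Poly_Mapping.lookup (snd (c i)) (m, n) \<noteq> 0"
          by (auto simp: prod_eq_iff poly_mapping_eq_iff fun_eq_iff)
        then have "(m, n) \<in> ?K \<and> i = m + n + 1"
          by (auto simp: c_def part in_keys_iff split: if_splits)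
        then show "i \<in> (\<lambda>(m, n). m + n + 1) ` ?K" by force
      qed
    qed auto
    have cG: "\<forall>i. c i \<in> laurent_grading i" by (auto simp: G c_def part)
    have F: "F = (\<Sum>i | c i \<noteq> 0. c i)"
      using look[OF fin cG]
      by (auto simp: prod_eq_iff poly_mapping_eq_iff fun_eq_iff c_def part)
    have uniq: "e = c" if e: "finite {i. e i \<noteq> 0}" "\<forall>i. e i \<in> laurent_grading i"
      "F = (\<Sum>i | e i \<noteq> 0. e i)" for e
    proof
      fix i
      show "e i = c i"
        using look[OF e(1,2), folded e(3)] e(2)
        by (auto simp: prod_eq_iff poly_mapping_eq_iff fun_eq_iff c_def part G)
    qed
    show ?thesis
    proof (rule ex1I[of _ c])
      show "finite {i. c i \<noteq> 0} \<and> (\<forall>i. c i \<in> laurent_grading i) \<and> F = (\<Sum>i | c i \<noteq> 0. c i)"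
        by (intro conjI fin cG F)
    next
      fix e
      assume "finite {i. e i \<noteq> 0} \<and> (\<forall>i. e i \<in> laurent_grading i) \<and> F = (\<Sum>i | e i \<noteq> 0. e i)"
      then show "e = c" by (elim conjE) (rule uniq)
    qed
  qed
  moreover have "laurent_perm F H \<in> laurent_grading (i + j)"
    if F: "F \<in> laurent_grading i" and H: "H \<in> laurent_grading j"
    for i j and F H :: "'k laurent2 \<times> 'k laurent2"
  proof -
    let ?hom = "\<lambda>d f. \<forall>p\<in>Poly_Mapping.keys f. fst p + snd p = d"
    have mult: "?hom (d + e) (f * g)" if "?hom d f" "?hom e g" for d e and f g :: "'k laurent2"
      using that keys_mult[of f g] by force
    have add: "?hom d (f + g)" if "?hom d f" "?hom d g" for d and f g :: "'k laurent2"
      using that keys_add[of f g] by blast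
    have x: "?hom 1 (laurent_x1 :: 'k laurent2)" "?hom 1 (laurent_x2 :: 'k laurent2)"
      by (auto simp: laurent_x1_def laurent_x2_def)
    have FH: "?hom (i - 1) (fst F)" "?hom (i - 1) (snd F)" "?hom (j - 1) (fst H)" "?hom (j - 1) (snd H)"
      using F H by (auto simp: laurent_grading_def)
    let ?h = "laurent_x1 * fst F + laurent_x2 * snd F"
    have "?hom (1 + (i - 1)) ?h" by (intro add mult x FH)
    then have "?hom (1 + (i - 1) + (j - 1)) (?h * fst H)" "?hom (1 + (i - 1) + (j - 1)) (?h * snd H)"
      by (intro mult FH; simp)+
    then show ?thesis
      by (auto simp: laurent_grading_def laurent_perm_def Let_def)
  qed
  ultimately show ?thesis
    unfolding graded_perm_algebra_def direct_sum_decomposition_def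
    using perm_algebra_laurent sub by blast
qed

lemma laurent_component_not_finite_dim:
  "\<not> finite_dim (laurent_scale :: 'k::field \<Rightarrow> _) (laurent_grading i)"
proof
  interpret vector_space "laurent_scale :: 'k \<Rightarrow> _" by (rule vector_space_laurent_scale)
  assume "finite_dim (laurent_scale :: 'k \<Rightarrow> _) (laurent_grading i)"
  then obtain S :: "('k laurent2 \<times> 'k laurent2) set"
    where S: "finite S" "span S = laurent_grading i" by (auto simp: finite_dim_def)
  define K where "K = (\<Union>F\<in>S. Poly_Mapping.keys (fst F))"
  have "Poly_Mapping.keys (fst F) \<subseteq> K" if "F \<in> span S" for F
    using that
  proof (induction rule: span_induct_alt)
    case (step c x y)
    have "Poly_Mapping.keys (fst (laurent_scale c x + y)) \<subseteq>
        Poly_Mapping.keys (fst x) \<union> Poly_Mapping.keys (fst y)"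
      by (auto simp: in_keys_iff lookup_add laurent_scale_def)
    then show ?case using step unfolding K_def by blast
  qed auto
  moreover have "laurent_monom m (i - 1 - m) 1 \<in> span S" for m
    unfolding S(2) by (auto simp: laurent_grading_def laurent_monom_def)
  ultimately have "(m, i - 1 - m) \<in> K" for m
    by (fastforce simp: laurent_monom_def)
  then have "range (\<lambda>m. (m, i - 1 - m)) \<subseteq> K" by blast
  moreover have "finite K" using S by (auto simp: K_def)
  ultimately have "finite (range (\<lambda>m::int. (m, i - 1 - m)))" by (rule finite_subset)
  moreover have "inj (\<lambda>m::int. (m, i - 1 - m))" by (auto simp: inj_def)
  ultimately show False using finite_imageD infinite_UNIV_int by blast
qed

end

theory Submission
  imports Defs
begin

text \<open>
  In a perm algebra a product of three elements depends only on its last factor, so every iterated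
  product of \<open>a1 \<otimes> b1\<close>, \<open>a2 \<otimes> b2\<close>, \<open>a3 \<otimes> b3\<close> has the form \<open>u1 \<otimes> \<beta>1 + u2 \<otimes> \<beta>2 + u3 \<otimes> \<beta>3\<close>,
  where \<open>\<beta>i\<close> is the product of the \<open>b\<close>'s ending in \<open>bi\<close>. In the Poisson identities the
  coefficients of \<open>\<beta>1, \<beta>2, \<beta>3\<close> are instances of the pre-Poisson identities. Conversely, for
  \<open>b1 = b2 = \<partial>1\<close>, \<open>b3 = \<partial>2\<close> in the Laurent algebra, \<open>\<beta>3 = x1^2 \<partial>2\<close> while
  \<open>\<beta>1 = \<beta>2 = x1 x2 \<partial>1\<close>, and the functional reading off the coefficient of \<open>x1^2 \<partial>2\<close> isolates
  the coefficient of \<open>\<beta>3\<close>; permuting the roles of the three factors gives the other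
  ones. The grading is handled through the projections \<open>1 \<otimes> \<pi>i\<close>.
\<close>

section \<open>Direct sums and projections\<close>

text \<open>The homogeneous components as linear functions of the vector. Linear maps, unlike the
  unique-existence clause of \<open>direct_sum_decomposition\<close>, can be tensored with the
  identity of \<open>A\<close>.\<close>

definition graded_projections ::
  "('k::field \<Rightarrow> 'v::ab_group_add \<Rightarrow> 'v) \<Rightarrow> (int \<Rightarrow> 'v set) \<Rightarrow> (int \<Rightarrow> 'v \<Rightarrow> 'v) \<Rightarrow> bool" where
  "graded_projections s G \<pi> \<longleftrightarrow>
     (\<forall>i. Vector_Spaces.linear s s (\<pi> i)) \<and> (\<forall>i v. \<pi> i v \<in> G i) \<and>
     (\<forall>i j. \<forall>v\<in>G j. \<pi> i v = (if i = j then v else 0)) \<and>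
     (\<forall>v. finite {i. \<pi> i v \<noteq> 0} \<and> v = (\<Sum>i | \<pi> i v \<noteq> 0. \<pi> i v))"

text \<open>Cancellation can make the support of the sum smaller than the union of the two supports,
  so all three sums are compared over that union.\<close>

lemma sum_nonzero_add:
  fixes c d :: "'i \<Rightarrow> 'v::ab_group_add"
  assumes "finite {i. c i \<noteq> 0}" "finite {i. d i \<noteq> 0}"
  shows "finite {i. c i + d i \<noteq> 0}"
    and "(\<Sum>i | c i + d i \<noteq> 0. c i + d i) = (\<Sum>i | c i \<noteq> 0. c i) + (\<Sum>i | d i \<noteq> 0. d i)"
proof -
  let ?K = "{i. c i \<noteq> 0} \<union> {i. d i \<noteq> 0}"
  have K: "finite ?K" using assms by blast
  show "finite {i. c i + d i \<noteq> 0}" by (rule finite_subset[OF _ K]) auto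
  have "sum e {i. e i \<noteq> 0} = sum e ?K" if "{i. e i \<noteq> 0} \<subseteq> ?K" for e :: "'i \<Rightarrow> 'v"
    using K that by (intro sum.mono_neutral_left) auto
  from this[of c] this[of d] this[of "\<lambda>i. c i + d i"]
  show "(\<Sum>i | c i + d i \<noteq> 0. c i + d i) = (\<Sum>i | c i \<noteq> 0. c i) + (\<Sum>i | d i \<noteq> 0. d i)"
    by (fastforce simp: sum.distrib)
qed

text \<open>Linearity comes from uniqueness: adding or scaling decompositions componentwise gives
  decompositions of the sum or multiple, hence the chosen ones.\<close>

lemma direct_sum_decomposition_projections:
  assumes V: "vector_space s" and D: "direct_sum_decomposition s G"
  obtains \<pi> where "graded_projections s G \<pi>"
proof -
  interpret vector_space s by fact
  have sub: "subspace (G i)" for i using D by (simp add: direct_sum_decomposition_def)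
  let ?P = "\<lambda>v c. finite {i. c i \<noteq> 0} \<and> (\<forall>i. c i \<in> G i) \<and> v = (\<Sum>i | c i \<noteq> 0. c i)"
  have ex1: "\<exists>!c. ?P v c" for v using D by (simp add: direct_sum_decomposition_def)
  then obtain p where p: "\<And>v. ?P v (p v)" by metis
  have uniq: "p v = c" if "?P v c" for v c using ex1[of v] p[of v] that by blast
  have add: "p (v + w) = (\<lambda>i. p v i + p w i)" for v w
    using p[of v] p[of w] sum_nonzero_add[of "p v" "p w"] subspace_add[OF sub]
    by (intro uniq) simp
  have scale: "p (s c v) = (\<lambda>i. s c (p v i))" for c v
  proof (rule uniq)
    have "s c v = (\<Sum>i | p v i \<noteq> 0. s c (p v i))" using p[of v] by (metis scale_sum_right)
    also have "\<dots> = (\<Sum>i | s c (p v i) \<noteq> 0. s c (p v i))"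
      using p[of v] by (intro sum.mono_neutral_right) auto
    finally have "s c v = (\<Sum>i | s c (p v i) \<noteq> 0. s c (p v i))" .
    moreover have "finite {i. s c (p v i) \<noteq> 0}"
      by (rule finite_subset[of _ "{i. p v i \<noteq> 0}"]) (use p[of v] in auto)
    ultimately show "?P (s c v) (\<lambda>i. s c (p v i))"
      using p[of v] subspace_scale[OF sub] by blast
  qed
  have hom: "p v = (\<lambda>i. if i = j then v else 0)" if "v \<in> G j" for v j
  proof (rule uniq)
    \<comment> \<open>For \<open>v = 0\<close> the support is empty rather than
      \<open>{j}\<close>.\<close>
    have "{i. (if i = j then v else 0) \<noteq> 0} = (if v = 0 then {} else {j})" by auto
    then show "?P v (\<lambda>i. if i = j then v else 0)"
      using that subspace_0[OF sub] by auto
  qed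
  have "graded_projections s G (\<lambda>i v. p v i)"
    unfolding graded_projections_def linear_iff
    using V add scale hom p by auto
  then show ?thesis by (rule that)
qed

text \<open>Existence is built into the projections. For uniqueness, \<open>\<pi> i\<close> applied
  to any decomposition of \<open>v\<close> kills all components but the \<open>i\<close>-th.\<close>

lemma graded_projections_direct_sum:
  assumes sub: "\<And>i. module.subspace s (G i)" and P: "graded_projections s G \<pi>"
  shows "direct_sum_decomposition s G"
proof -
  have "c = (\<lambda>i. \<pi> i v)"
    if c: "finite {i. c i \<noteq> 0}" "\<forall>i. c i \<in> G i" "v = (\<Sum>i | c i \<noteq> 0. c i)" for c v
  proof
    fix i
    interpret Vector_Spaces.linear s s "\<pi> i" using P by (simp add: graded_projections_def)
    have "\<pi> i v = (\<Sum>j | c j \<noteq> 0. if i = j then c j else 0)"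
      unfolding c(3) sum using P c(2) by (intro sum.cong) (auto simp: graded_projections_def)
    then show "c i = \<pi> i v" using c(1) by (simp add: sum.delta)
  qed
  then show ?thesis
    unfolding direct_sum_decomposition_def using sub P[unfolded graded_projections_def]
    by (intro conjI allI ex1I[of _ "\<lambda>i. \<pi> i _"]) blast+
qed


section \<open>Extension from pure tensors\<close>

text \<open>There is no case for scalars: a coefficient is absorbed into the left factor of its pure
  tensor.\<close>

lemma tensor_induct [consumes 1, case_names tens zero add]:
  assumes T: "tensor_product sA sB sT tens"
    and "\<And>a b. P (tens a b)" "P 0" "\<And>x y. P x \<Longrightarrow> P y \<Longrightarrow> P (x + y)"
  shows "P t"
proof -
  interpret tensor_product sA sB sT tens by fact
  obtain f where t: "t = free_extend sT (\<lambda>(a, b). tens a b) f" using surj by blast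
  have "P (\<Sum>x\<in>K. sT (Poly_Mapping.lookup f x) (case x of (a, b) \<Rightarrow> tens a b))"
    if "finite K" for K
    using that
  proof (induction K rule: finite_induct)
    case (insert x K)
    then show ?case
      using assms(2-4)
      by (cases x) (simp flip: bilinear_mapD(3)[OF tensor_product_bilinear[OF T]])
  qed (use assms in simp)
  then show ?thesis unfolding t free_extend_def by simp
qed

text \<open>With its two- and three-variable forms, this reduces the Poisson identities, written as
  \<open>f = 0\<close>, to pure tensors.\<close>

lemma tensor_additive_zero:
  fixes f :: "'t::ab_group_add \<Rightarrow> 'v::ab_group_add"
  assumes T: "tensor_product sA sB sT tens"
    and "\<And>x y. f (x + y) = f x + f y" "\<And>a b. f (tens a b) = 0"
  shows "f t = 0"
  using T
proof (induction t rule: tensor_induct)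
  case zero
  show ?case using assms(2)[of 0 0] by simp
qed (simp_all add: assms)

lemma tensor_biadditive_zero:
  fixes f :: "'t::ab_group_add \<Rightarrow> 't \<Rightarrow> 'v::ab_group_add"
  assumes T: "tensor_product sA sB sT tens"
    and add: "\<And>x x' y. f (x + x') y = f x y + f x' y" "\<And>x y y'. f x (y + y') = f x y + f x y'"
    and tens: "\<And>a1 b1 a2 b2. f (tens a1 b1) (tens a2 b2) = 0"
  shows "f x y = 0"
proof -
  have *: "f (tens a1 b1) y = 0" for a1 b1
    by (rule tensor_additive_zero[OF T, where f = "f (tens a1 b1)"]) (rule add(2) tens)+
  show ?thesis
    by (rule tensor_additive_zero[OF T, where f = "\<lambda>x. f x y"]) (rule add(1) *)+
qed

lemma tensor_triadditive_zero:
  fixes f :: "'t::ab_group_add \<Rightarrow> 't \<Rightarrow> 't \<Rightarrow> 'v::ab_group_add"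
  assumes T: "tensor_product sA sB sT tens"
    and add: "\<And>x x' y z. f (x + x') y z = f x y z + f x' y z"
      "\<And>x y y' z. f x (y + y') z = f x y z + f x y' z"
      "\<And>x y z z'. f x y (z + z') = f x y z + f x y z'"
    and tens: "\<And>a1 b1 a2 b2 a3 b3. f (tens a1 b1) (tens a2 b2) (tens a3 b3) = 0"
  shows "f x y z = 0"
proof -
  have *: "f (tens a1 b1) y z = 0" for a1 b1
    by (rule tensor_biadditive_zero[OF T, where f = "f (tens a1 b1)"]) (rule add(2,3) tens)+
  show ?thesis
    by (rule tensor_additive_zero[OF T, where f = "\<lambda>x. f x y z"]) (rule add(1) *)+
qed

lemma
  assumes T: "tensor_product sA sB sT tens"
    and p: "bilinear_map sA sA sA p" and q: "bilinear_map sB sB sB q"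
  shows bilinear_tensor_dot: "bilinear_map sT sT sT (tensor_dot sT tens p q)"
    and tensor_dot_tens: "tensor_dot sT tens p q (tens a1 b1) (tens a2 b2) =
      tens (p a1 a2) (q b1 b2) + tens (p a2 a1) (q b2 b1)"
  using theI'[OF tensor_op_well_defined(1)[OF assms]] unfolding tensor_dot_def by blast+

lemma
  assumes T: "tensor_product sA sB sT tens"
    and p: "bilinear_map sA sA sA p" and q: "bilinear_map sB sB sB q"
  shows bilinear_tensor_bracket: "bilinear_map sT sT sT (tensor_bracket sT tens p q)"
    and tensor_bracket_tens: "tensor_bracket sT tens p q (tens a1 b1) (tens a2 b2) =
      tens (p a1 a2) (q b1 b2) - tens (p a2 a1) (q b2 b1)"
  using theI'[OF tensor_op_well_defined(2)[OF assms]] unfolding tensor_bracket_def by blast+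

lemma bilinear_map_diffD:
  assumes "bilinear_map s1 s2 s3 f"
  shows "f (x - x') y = f x y - f x' y" "f x (y - y') = f x y - f x y'"
  using bilinear_mapD(1)[OF assms, of "x - x'" x' y, symmetric]
    bilinear_mapD(2)[OF assms, of x "y - y'" y', symmetric]
  by (simp_all add: eq_diff_eq)

text \<open>Reduces to generators both the degree of a product and the spanning of a component by
  finitely many tensors.\<close>

lemma bilinear_map_span:
  assumes f: "bilinear_map s1 s2 s3 f"
    and gen: "\<And>x y. x \<in> X \<Longrightarrow> y \<in> Y \<Longrightarrow> f x y \<in> module.span s3 Z"
    and x: "x \<in> module.span s1 X" and y: "y \<in> module.span s2 Y"
  shows "f x y \<in> module.span s3 Z"
proof -
  have V: "vector_space s1" "vector_space s2" "vector_space s3"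
    using f by (auto simp: bilinear_map_def linear_iff)
  interpret V1: vector_space s1 by (rule V)
  interpret V2: vector_space s2 by (rule V)
  interpret V3: vector_space s3 by (rule V)
  note fD = bilinear_mapD[OF f]
  have zero: "f 0 y = 0" "f x 0 = 0" for x y
    using bilinear_map_diffD[OF f, of 0 0] bilinear_map_diffD(2)[OF f, of _ 0 0] by simp_all
  have *: "f x y \<in> V3.span Z" if "x \<in> X" for x
    using y by (induction rule: V2.span_induct_alt)
      (auto simp: zero fD that gen intro!: V3.span_add V3.span_scale V3.span_zero)
  show ?thesis
    using x by (induction rule: V1.span_induct_alt)
      (auto simp: zero fD * intro!: V3.span_add V3.span_scale V3.span_zero)
qed


section \<open>The grading of the tensor product\<close>

lemma direct_sum_tensor_grading:
  assumes T: "tensor_product sA sB sT tens" and D: "direct_sum_decomposition sB G"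
  shows "direct_sum_decomposition sT (tensor_grading sT tens G)"
proof -
  interpret tensor_product sA sB sT tens by fact
  interpret T: vector_space sT by (rule vector_space_tensor)
  note b = tensor_product_bilinear[OF T]
  note bD = bilinear_mapD[OF b]
  have t0: "tens a 0 = 0" for a using bilinear_map_diffD(2)[OF b, of a 0 0] by simp
  obtain \<pi> where \<pi>: "graded_projections sB G \<pi>"
    using direct_sum_decomposition_projections[OF vector_space_right D] .
  note \<pi>D = \<pi>[unfolded graded_projections_def linear_iff]
  \<comment> \<open>The universal property turns this into \<open>\<phi> i\<close>, the identity of
    \<open>A\<close> tensored with \<open>\<pi> i\<close>.\<close>
  have "bilinear_map sA sB sT (\<lambda>a b. tens a (\<pi> i b))" for i
    using \<pi>D by (intro bilinear_mapI vector_space_left vector_space_right vector_space_tensor)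
      (simp_all add: bD)
  then have "\<exists>\<phi>. Vector_Spaces.linear sT sT \<phi> \<and> (\<forall>a b. \<phi> (tens a b) = tens a (\<pi> i b))" for i
    using tensor_product_universal[OF T] by blast
  then obtain \<phi> where lin: "\<And>i. Vector_Spaces.linear sT sT (\<phi> i)"
    and \<phi>: "\<And>i a b. \<phi> i (tens a b) = tens a (\<pi> i b)" by metis
  note linD = lin[unfolded linear_iff]
  have \<phi>0: "\<phi> i 0 = 0" for i using linD[of i] by (metis add_cancel_left_left add.right_neutral)
  have sub: "T.subspace (tensor_grading sT tens G i)" for i
    by (simp add: tensor_grading_def)
  have mem: "\<phi> i t \<in> tensor_grading sT tens G i" for i t
    using T
  proof (induction t rule: tensor_induct)
    case (tens a b)
    have "\<pi> i b \<in> G i" using \<pi>D by blast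
    then show ?case unfolding \<phi> tensor_grading_def by (intro T.span_base) blast
  qed (use linD T.subspace_add[OF sub] T.subspace_0[OF sub] \<phi>0 in simp_all)
  have proj: "\<phi> i t = (if i = j then t else 0)" if "t \<in> tensor_grading sT tens G j" for i j t
    using that unfolding tensor_grading_def
  proof (induction rule: T.span_induct_alt)
    case (step c x y)
    then show ?case using linD[of i] \<pi>D by (auto simp: \<phi> t0)
  qed (simp add: \<phi>0)
  have decomp: "finite {i. \<phi> i t \<noteq> 0} \<and> t = (\<Sum>i | \<phi> i t \<noteq> 0. \<phi> i t)" for t
    using T
  proof (induction t rule: tensor_induct)
    case (tens a b)
    interpret l: Vector_Spaces.linear sB sT "tens a" using b by (simp add: bilinear_map_def)
    have fin: "finite {i. \<pi> i b \<noteq> 0}" and sum: "b = (\<Sum>i | \<pi> i b \<noteq> 0. \<pi> i b)"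
      using \<pi>D by blast+
    \<comment> \<open>The inclusion may be strict, for instance when \<open>a = 0\<close>.\<close>
    have ss: "{i. \<phi> i (tens a b) \<noteq> 0} \<subseteq> {i. \<pi> i b \<noteq> 0}" by (auto simp: \<phi> t0)
    have "tens a b = (\<Sum>i | \<pi> i b \<noteq> 0. tens a (\<pi> i b))"
      by (subst sum) (rule l.sum)
    also have "\<dots> = (\<Sum>i | \<phi> i (tens a b) \<noteq> 0. \<phi> i (tens a b))"
      unfolding \<phi>[symmetric] using fin ss by (intro sum.mono_neutral_right) auto
    finally show ?case using finite_subset[OF ss fin] by blast
  next
    case (add x y)
    then show ?case
      using sum_nonzero_add[of "\<lambda>i. \<phi> i x" "\<lambda>i. \<phi> i y"] linD by simp
  qed (simp add: \<phi>0)
  have "graded_projections sT (tensor_grading sT tens G) \<phi>"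
    unfolding graded_projections_def using lin mem proj decomp by blast
  then show ?thesis using sub by (intro graded_projections_direct_sum)
qed

lemma finite_dim_tensor_grading:
  assumes T: "tensor_product sA sB sT tens"
    and A: "finite_dim sA UNIV" and B: "finite_dim sB (G i)"
  shows "finite_dim sT (tensor_grading sT tens G i)"
proof -
  interpret tensor_product sA sB sT tens by fact
  interpret B: vector_space sB by (rule vector_space_right)
  interpret T: vector_space sT by (rule vector_space_tensor)
  obtain S R where S: "finite S" "module.span sA S = UNIV" and R: "finite R" "B.span R = G i"
    using A B by (auto simp: finite_dim_def)
  let ?Z = "(\<lambda>(a, b). tens a b) ` (S \<times> R)"
  have "T.span {tens a b | a b. b \<in> G i} = T.span ?Z"
  proof (rule T.span_eq[THEN iffD2], intro conjI)
    show "{tens a b | a b. b \<in> G i} \<subseteq> T.span ?Z"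
    proof clarify
      fix a b assume "b \<in> G i"
      then have a: "a \<in> module.span sA S" and b: "b \<in> B.span R" using S(2) R(2) by simp_all
      have "tens x y \<in> T.span ?Z" if "x \<in> S" "y \<in> R" for x y
        by (rule T.span_base) (use that in force)
      then show "tens a b \<in> T.span ?Z"
        by (rule bilinear_map_span[OF tensor_product_bilinear[OF T] _ a b])
    qed
    have "?Z \<subseteq> {tens a b | a b. b \<in> G i}"
      unfolding R(2)[symmetric] using B.span_superset[of R] by auto
    then show "?Z \<subseteq> T.span {tens a b | a b. b \<in> G i}"
      using T.span_superset by (rule order_trans)
  qed
  then show ?thesis
    unfolding finite_dim_def tensor_grading_def using S(1) R(1)
    by (intro exI[of _ ?Z]) simp
qed


section \<open>From pre-Poisson to Poisson\<close>

lemma poisson_algebra_tensor: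
  fixes sA :: "'k::field_char_0 \<Rightarrow> 'a::ab_group_add \<Rightarrow> 'a"
  assumes pp: "pre_poisson_algebra sA ast circ" and pm: "perm_algebra sB dia"
    and T: "tensor_product sA sB sT tens"
  shows "poisson_algebra sT (tensor_dot sT tens ast dia) (tensor_bracket sT tens circ dia)"
proof -
  interpret pre_poisson_algebra sA ast circ by fact
  interpret perm_algebra sB dia by fact
  interpret tensor_product sA sB sT tens by fact
  interpret T: vector_space sT by (rule vector_space_tensor)
  let ?d = "tensor_dot sT tens ast dia" and ?b = "tensor_bracket sT tens circ dia"
  note dm = bilinear_tensor_dot[OF T ast.bilinear bilinear]
    and bm = bilinear_tensor_bracket[OF T circ.bilinear bilinear]
    and tm = tensor_product_bilinear[OF T]
  note dD = bilinear_mapD(1,2)[OF dm] bilinear_map_diffD[OF dm]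
    and bD = bilinear_mapD(1,2)[OF bm] bilinear_map_diffD[OF bm]
    and tD = bilinear_mapD(1,2)[OF tm] bilinear_map_diffD[OF tm]
    and aD = bilinear_mapD(1,2)[OF ast.bilinear] bilinear_map_diffD[OF ast.bilinear]
    and cD = bilinear_mapD(1,2)[OF circ.bilinear] bilinear_map_diffD[OF circ.bilinear]
  note dt = tensor_dot_tens[OF T ast.bilinear bilinear]
    and bt = tensor_bracket_tens[OF T circ.bilinear bilinear]
  \<comment> \<open>With right-nesting, ordered rewriting by \<open>lc\<close> sorts the first two
    factors, so each triple product gets a normal form determined by its last factor.\<close>
  have lc: "dia b1 (dia b2 b3) = dia b2 (dia b1 b3)" for b1 b2 b3
    by (metis assoc left_comm)
  note perm = assoc[symmetric] lc
  \<comment> \<open>The identities are solved for one term to serve as rewrite rules.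
    \<open>pl\<close> and \<open>ac\<close> would loop, as the mirrored term reappears on the right,
    so they are used below at fixed instances only; \<open>ca\<close> terminates.\<close>
  have pl: "circ a1 (circ a2 a3) = circ (circ a1 a2) a3 - circ (circ a2 a1) a3 + circ a2 (circ a1 a3)"
    for a1 a2 a3
    using circ.pre_lie[of a1 a2 a3] by (simp add: algebra_simps)
  have ca: "circ a1 (ast a2 a3) = ast (circ a1 a2) a3 - ast (circ a2 a1) a3 + ast a2 (circ a1 a3)"
    for a1 a2 a3
    using circ_ast[of a1 a2 a3] by (simp add: aD algebra_simps)
  have ac: "circ (ast a1 a2) a3 = ast a1 (circ a2 a3) + ast a2 (circ a1 a3) - circ (ast a2 a1) a3"
    for a1 a2 a3
    using ast_circ[of a1 a2 a3] by (simp add: cD algebra_simps)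
  have "?d x y - ?d y x = 0" for x y
    by (rule tensor_biadditive_zero[OF T, where f = "\<lambda>x y. ?d x y - ?d y x"])
      (simp_all add: dD dt)
  then have dcomm: "?d x y = ?d y x" for x y by (metis eq_iff_diff_eq_0)
  have banti: "?b x y + ?b y x = 0" for x y
    by (rule tensor_biadditive_zero[OF T, where f = "\<lambda>x y. ?b x y + ?b y x"])
      (simp_all add: bD bt)
  show ?thesis
  proof
    \<comment> \<open>This is quadratic in \<open>p\<close>, so it is derived from antisymmetry,
      dividing by 2 in characteristic zero.\<close>
    show "?b p p = 0" for p
    proof -
      have "sT 2 (?b p p) = 0"
        using banti[of p p] T.scale_left_distrib[of 1 1 "?b p p"] by simp
      then show ?thesis by simp
    qed
    fix x y z
    have "?d (?d x y) z - ?d x (?d y z) = 0"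
      by (rule tensor_triadditive_zero[OF T, where f = "\<lambda>x y z. ?d (?d x y) z - ?d x (?d y z)"])
        (simp_all add: dD dt tD aD perm ast.zinbiel)
    then show "?d (?d x y) z = ?d x (?d y z)" by simp
    show "?b x (?b y z) + ?b y (?b z x) + ?b z (?b x y) = 0"
    proof (rule tensor_triadditive_zero[OF T,
          where f = "\<lambda>x y z. ?b x (?b y z) + ?b y (?b z x) + ?b z (?b x y)"], goal_cases)
      case (4 a1 b1 a2 b2 a3 b3)
      then show ?case
        \<comment> \<open>One cyclic instance of pre-Lie for each possible last factor
          \<open>b3\<close>, \<open>b1\<close>, \<open>b2\<close>.\<close>
        by (simp add: bD bt tD cD perm pl[of a1 a2 a3] pl[of a2 a3 a1] pl[of a3 a1 a2])
    qed (simp_all add: bD)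
    have "?b x (?d y z) - ?d (?b x y) z - ?d y (?b x z) = 0"
    proof (rule tensor_triadditive_zero[OF T,
          where f = "\<lambda>x y z. ?b x (?d y z) - ?d (?b x y) z - ?d y (?b x z)"], goal_cases)
      case (4 a1 b1 a2 b2 a3 b3)
      then show ?case
        \<comment> \<open>\<open>ca\<close> settles the products ending in \<open>b2\<close> or
          \<open>b3\<close>, and \<open>ac\<close> those ending in \<open>b1\<close>.\<close>
        by (simp add: bD dD bt dt tD aD cD perm ca ac[of a2 a3 a1])
    qed (simp_all add: bD dD)
    then show "?b x (?d y z) = ?d (?b x y) z + ?d y (?b x z)" by (simp add: algebra_simps)
  qed (fact vector_space_tensor dm bm dcomm)+
qed

text \<open>Stated for \<open>graded_perm_algebra\<close> so as to cover the Laurent algebra, whose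
  components are infinite-dimensional; for \<open>B\<close> finite-dimensionality is added
  afterwards.\<close>

lemma graded_poisson_algebra_tensor:
  fixes sA :: "'k::field_char_0 \<Rightarrow> 'a::ab_group_add \<Rightarrow> 'a"
  assumes pp: "pre_poisson_algebra sA ast circ" and gp: "graded_perm_algebra sB dia G"
    and T: "tensor_product sA sB sT tens"
  shows "graded_poisson_algebra sT (tensor_dot sT tens ast dia) (tensor_bracket sT tens circ dia)
    (tensor_grading sT tens G)"
proof -
  interpret pre_poisson_algebra sA ast circ by fact
  interpret tensor_product sA sB sT tens by fact
  interpret T: vector_space sT by (rule vector_space_tensor)
  have pm: "perm_algebra sB dia" and D: "direct_sum_decomposition sB G"
    and G: "\<And>i j x y. x \<in> G i \<Longrightarrow> y \<in> G j \<Longrightarrow> dia x y \<in> G (i + j)"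
    using gp by (auto simp: graded_perm_algebra_def)
  interpret perm_algebra sB dia by fact
  have mem: "tens a (dia x y) \<in> T.span {tens a b | a b. b \<in> G (i + j)}"
    "tens a (dia y x) \<in> T.span {tens a b | a b. b \<in> G (i + j)}"
    if "x \<in> G i" "y \<in> G j" for a x y i j
    using G[OF that] G[OF that(2,1)] by (auto intro!: T.span_base simp: add.commute)
  show ?thesis
    unfolding graded_poisson_algebra_def
  proof (intro conjI allI ballI poisson_algebra_tensor[OF pp pm T] direct_sum_tensor_grading[OF T D])
    fix i j x y
    assume "x \<in> tensor_grading sT tens G i" "y \<in> tensor_grading sT tens G j"
    then show "tensor_dot sT tens ast dia x y \<in> tensor_grading sT tens G (i + j)"
      unfolding tensor_grading_def
      by (rule bilinear_map_span[OF bilinear_tensor_dot[OF T ast.bilinear bilinear], rotated])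
        (auto simp: tensor_dot_tens[OF T ast.bilinear bilinear] intro!: T.span_add intro: mem)
  next
    fix i j x y
    assume "x \<in> tensor_grading sT tens G i" "y \<in> tensor_grading sT tens G j"
    then show "tensor_bracket sT tens circ dia x y \<in> tensor_grading sT tens G (i + j)"
      unfolding tensor_grading_def
      by (rule bilinear_map_span[OF bilinear_tensor_bracket[OF T circ.bilinear bilinear], rotated])
        (auto simp: tensor_bracket_tens[OF T circ.bilinear bilinear] intro!: T.span_diff intro: mem)
  qed
qed


section \<open>From Poisson to pre-Poisson over the Laurent algebra\<close>

lemma pre_poisson_algebra_of_laurent:
  fixes sA :: "'k::field \<Rightarrow> 'a::ab_group_add \<Rightarrow> 'a"
  assumes T: "tensor_product sA laurent_scale sL tens"
    and am: "bilinear_map sA sA sA ast" and cm: "bilinear_map sA sA sA circ"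
    and P: "poisson_algebra sL (tensor_dot sL tens ast laurent_perm)
      (tensor_bracket sL tens circ laurent_perm)"
  shows "pre_poisson_algebra sA ast circ"
proof -
  interpret tensor_product sA laurent_scale sL tens by fact
  interpret A: vector_space sA by (rule vector_space_left)
  interpret L: perm_algebra "laurent_scale :: 'k \<Rightarrow> _" laurent_perm by (rule perm_algebra_laurent)
  interpret poisson_algebra sL "tensor_dot sL tens ast laurent_perm"
    "tensor_bracket sL tens circ laurent_perm" by fact
  let ?d = "tensor_dot sL tens ast laurent_perm" and ?b = "tensor_bracket sL tens circ laurent_perm"
  note dD = bilinear_mapD(1,2)[OF dot_bilinear] bilinear_map_diffD[OF dot_bilinear]
    and bD = bilinear_mapD(1,2)[OF bracket_bilinear] bilinear_map_diffD[OF bracket_bilinear]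
    and aD = bilinear_mapD(1,2)[OF am] bilinear_map_diffD[OF am]
    and cD = bilinear_mapD(1,2)[OF cm] bilinear_map_diffD[OF cm]
  note dt = tensor_dot_tens[OF T am L.bilinear] and bt = tensor_bracket_tens[OF T cm L.bilinear]
  define \<gamma> :: "'k laurent2 \<times> 'k laurent2 \<Rightarrow> 'k" where
    "\<gamma> F = Poly_Mapping.lookup (snd F) (2, 0)" for F
  \<comment> \<open>The induced \<open>\<phi>\<close> is the identity of \<open>A\<close> tensored
    with \<open>\<gamma>\<close>: on triple products of two \<open>X\<close> and one
    \<open>Y\<close> it keeps exactly the \<open>A\<close>-coefficients of those ending in
    \<open>Y\<close>.\<close>
  have "bilinear_map sA laurent_scale sA (\<lambda>a F. sA (\<gamma> F) a)"
    by (rule bilinear_mapI[OF vector_space_left vector_space_right vector_space_left])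
      (simp_all add: \<gamma>_def lookup_add laurent_scale_def A.scale_left_distrib A.scale_right_distrib
        mult.commute)
  then obtain \<phi> where lin: "Vector_Spaces.linear sL sA \<phi>"
    and \<phi>: "\<And>a F. \<phi> (tens a F) = sA (\<gamma> F) a"
    using tensor_product_universal[OF T] by blast
  interpret \<phi>: Vector_Spaces.linear sL sA \<phi> by (rule lin)
  obtain X Y :: "'k laurent2 \<times> 'k laurent2" where
    \<gamma>: "\<gamma> (laurent_perm X (laurent_perm X Y)) = 1"
      "\<gamma> (laurent_perm X (laurent_perm Y X)) = 0" "\<gamma> (laurent_perm Y (laurent_perm X X)) = 0"
  proof
    let ?X = "laurent_monom 0 0 1 :: 'k laurent2 \<times> 'k laurent2"
      and ?Y = "laurent_monom 0 0 2 :: 'k laurent2 \<times> 'k laurent2"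
    show "\<gamma> (laurent_perm ?X (laurent_perm ?X ?Y)) = 1"
      "\<gamma> (laurent_perm ?X (laurent_perm ?Y ?X)) = 0"
      "\<gamma> (laurent_perm ?Y (laurent_perm ?X ?X)) = 0"
      by (simp_all add: \<gamma>_def laurent_perm_def laurent_monom_def laurent_x1_def laurent_x2_def
          mult_single Let_def lookup_single)
  qed
  note simps = dD bD dt bt \<phi>.add \<phi>.diff \<phi> L.assoc[symmetric] \<gamma>
  show ?thesis
  proof
    fix a1 a2 a3
    show "ast a1 (ast a2 a3) = ast (ast a1 a2) a3 + ast (ast a2 a1) a3"
      using arg_cong[OF dot_assoc[of "tens a1 X" "tens a2 X" "tens a3 Y"], of \<phi>]
      by (simp add: simps)
    show "circ (circ a1 a2) a3 - circ a1 (circ a2 a3) =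
        circ (circ a2 a1) a3 - circ a2 (circ a1 a3)"
      using arg_cong[OF jacobi[of "tens a1 X" "tens a2 X" "tens a3 Y"], of \<phi>]
      by (simp add: simps \<phi>.zero algebra_simps)
    show "ast (circ a1 a2 - circ a2 a1) a3 = circ a1 (ast a2 a3) - ast a2 (circ a1 a3)"
      using arg_cong[OF leibniz[of "tens a1 X" "tens a2 X" "tens a3 Y"], of \<phi>]
      by (simp add: simps aD)
    \<comment> \<open>This identity is the coefficient of the products ending in the first argument
      of the Leibniz rule, so \<open>Y\<close> moves there.\<close>
    show "circ (ast a1 a2 + ast a2 a1) a3 = ast a1 (circ a2 a3) + ast a2 (circ a1 a3)"
      using arg_cong[OF leibniz[of "tens a3 Y" "tens a1 X" "tens a2 X"], of \<phi>]
      by (simp add: simps cD algebra_simps)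
  qed (fact vector_space_left am cm)+
qed

theorem proposition4p8:
  fixes sA :: "'k::field_char_0 \<Rightarrow> 'a::ab_group_add \<Rightarrow> 'a"
    and ast circ :: "'a \<Rightarrow> 'a \<Rightarrow> 'a"
    and sB :: "'k \<Rightarrow> 'b::ab_group_add \<Rightarrow> 'b"
    and dia :: "'b \<Rightarrow> 'b \<Rightarrow> 'b"
    and B :: "int \<Rightarrow> 'b set"
    and sT :: "'k \<Rightarrow> 't::ab_group_add \<Rightarrow> 't"
    and tens :: "'a \<Rightarrow> 'b \<Rightarrow> 't"
    and sL :: "'k \<Rightarrow> 'l::ab_group_add \<Rightarrow> 'l"
    and tensL :: "'a \<Rightarrow> 'k laurent2 \<times> 'k laurent2 \<Rightarrow> 'l"
  shows
    "(pre_poisson_algebra sA ast circ \<and> finite_dim sA UNIV \<and>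
      Z_graded_perm_algebra sB dia B \<and>
      tensor_product sA sB sT tens \<longrightarrow>
        Z_graded_poisson_algebra sT
          (tensor_dot sT tens ast dia) (tensor_bracket sT tens circ dia)
          (tensor_grading sT tens B))
     \<and>
     (vector_space sA \<and> finite_dim sA UNIV \<and>
      bilinear_map sA sA sA ast \<and> bilinear_map sA sA sA circ \<and>
      tensor_product sA laurent_scale sL tensL \<longrightarrow>
        (graded_poisson_algebra sL
           (tensor_dot sL tensL ast laurent_perm) (tensor_bracket sL tensL circ laurent_perm)
           (tensor_grading sL tensL laurent_grading)
         \<longleftrightarrow> pre_poisson_algebra sA ast circ))"
proof (intro conjI impI; elim conjE)
  assume pp: "pre_poisson_algebra sA ast circ" and A: "finite_dim sA UNIV"
    and B: "Z_graded_perm_algebra sB dia B" and T: "tensor_product sA sB sT tens"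
  show "Z_graded_poisson_algebra sT
      (tensor_dot sT tens ast dia) (tensor_bracket sT tens circ dia) (tensor_grading sT tens B)"
    using graded_poisson_algebra_tensor[OF pp _ T] finite_dim_tensor_grading[OF T A] B
    by (simp add: Z_graded_poisson_algebra_def Z_graded_perm_algebra_def)
next
  assume am: "bilinear_map sA sA sA ast" and cm: "bilinear_map sA sA sA circ"
    and T: "tensor_product sA laurent_scale sL tensL"
  show "graded_poisson_algebra sL
      (tensor_dot sL tensL ast laurent_perm) (tensor_bracket sL tensL circ laurent_perm)
      (tensor_grading sL tensL laurent_grading) \<longleftrightarrow> pre_poisson_algebra sA ast circ"
    using graded_poisson_algebra_tensor[OF _ graded_perm_algebra_laurent T]
      pre_poisson_algebra_of_laurent[OF T am cm]
    by (auto simp: graded_poisson_algebra_def)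
qed

end
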